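(* Let $\mathcal{M}$ be a $k$-orbit $(n-1)$-maniplex and let $T(\mathcal{M})$ be its symmetry type graph. Suppose $T(\mathcal{M})$ has a Hamiltonian path $v_1,e_1,v_2,e_2,\dots,e_{k-1},v_k$, where $e_m$ is an edge of colour $a_m$ joining $v_m$ and $v_{m+1}$. For each $i\in\{1,\dots,k\}$ let $S_i\subseteq\{0,\dots,n-1\}$ be the set of colours $s$ such that $v_i$ carries a semi-edge of colour $s$. For $1\le i<j\le k$ let $B_{i,j}$ be the set of colours of the edges joining $v_i$ and $v_j$ that are not edges of the path. Let $\Phi$ be a flag of $\mathcal{M}$ lying in the orbit $v_1$. Then $\mathrm{Aut}(\mathcal{M})$ is generated by the union of $$\{\alpha_{a_1,\dots,a_{i-1},s,a_{i-1},\dots,a_1}\mid 1\le i\le k,\ s\in S_i\}$$ and $$\{\alpha_{a_1,\dots,a_{i-1},b,a_{j-1},\dots,a_1}\mid 1\le i<j\le k,\ b\in B_{i,j}\}$$ (where for $i=1$ the index sequence $a_1,\dots,a_{i-1}$ is empty).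
   Context: An $(n-1)$-maniplex is given by a connected simple graph (flag graph), whose vertices are called flags, with a proper edge-colouring by colours $\{0,\dots,n-1\}$, each colour class a perfect matching, such that for colours $i,j$ with $|i-j|\ge2$ each component of the subgraph spanned by colours $i,j$ is a 4-cycle. $\Phi^i$ denotes the flag $i$-adjacent to $\Phi$, and $\Phi^{c_1,c_2,\dots,c_m}=(\cdots((\Phi^{c_1})^{c_2})\cdots)^{c_m}$. Automorphisms are colour-preserving graph automorphisms; $k$-orbit means $\mathrm{Aut}(\mathcal{M})$ has exactly $k$ orbits on flags, and $\mathrm{Aut}(\mathcal{M})$ acts freely on flags. For a fixed base flag $\Phi$ and a colour sequence $c_1,\dots,c_m$ such that $\Phi^{c_1,\dots,c_m}$ lies in the $\mathrm{Aut}(\mathcal{M})$-orbit of $\Phi$, $\alpha_{c_1,\dots,c_m}$ denotes the unique automorphism mapping $\Phi$ to $\Phi^{c_1,\dots,c_m}$. The symmetry type graph $T(\mathcal{M})$ is the pregraph whose vertices are the flag orbits, with an edge of colour $c$ between distinct orbits $B,C$ iff some flag of $B$ is $c$-adjacent to a flag of $C$, and a semi-edge of colour $c$ at $B$ iff some flag of $B$ is $c$-adjacent to a flag of $B$; each vertex carries exactly one edge or semi-edge of each colour. *)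

theory Defs
  imports "HOL-Algebra.Bij" "HOL-Algebra.Generated_Groups"
begin

record 'f flag_graph =
  flags :: "'f set"
  edges :: "'f set set"
  colour :: "'f set \<Rightarrow> nat"

definition edges_of_colours :: "'f flag_graph \<Rightarrow> nat set \<Rightarrow> 'f set set" where
  "edges_of_colours M C = {E \<in> edges M. colour M E \<in> C}"

definition component :: "'f set set \<Rightarrow> 'f \<Rightarrow> 'f set" where
  "component Es x = {y. (x, y) \<in> {(u, w). {u, w} \<in> Es}\<^sup>*}"

definition four_cycle :: "'f set \<Rightarrow> 'f set set \<Rightarrow> bool" where
  "four_cycle V Es \<longleftrightarrow>
    (\<exists>a b c d. distinct [a, b, c, d] \<and> V = {a, b, c, d} \<and>
       Es = {{a, b}, {b, c}, {c, d}, {d, a}})"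

text \<open>
  The parameter \<open>n\<close> is the number of colours, so \<open>maniplex M n\<close> says that \<open>M\<close> is
  (the flag graph of) an \<open>(n - 1)\<close>-maniplex. The flag graph may be infinite.
\<close>

locale maniplex =
  fixes M :: "'f flag_graph" and n :: nat
  assumes nonempty: "flags M \<noteq> {}"
    and simple: "E \<in> edges M \<Longrightarrow> \<exists>x\<in>flags M. \<exists>y\<in>flags M. x \<noteq> y \<and> E = {x, y}"
    and connected: "x \<in> flags M \<Longrightarrow> component (edges M) x = flags M"
    and colours: "E \<in> edges M \<Longrightarrow> colour M E < n"
    and proper: "\<lbrakk>E \<in> edges M; F \<in> edges M; E \<noteq> F; E \<inter> F \<noteq> {}\<rbrakk> \<Longrightarrow> colour M E \<noteq> colour M F"
    and perfect_matching:
      "\<lbrakk>c < n; x \<in> flags M\<rbrakk> \<Longrightarrow> \<exists>!E. E \<in> edges M \<and> colour M E = c \<and> x \<in> E"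
    and squares:
      "\<lbrakk>i < n; j < n; i + 2 \<le> j; x \<in> flags M; V = component (edges_of_colours M {i, j}) x\<rbrakk>
        \<Longrightarrow> four_cycle V {E \<in> edges_of_colours M {i, j}. E \<subseteq> V}"

definition adjacent :: "'f flag_graph \<Rightarrow> nat \<Rightarrow> 'f \<Rightarrow> 'f \<Rightarrow> bool" where
  "adjacent M c x y \<longleftrightarrow> {x, y} \<in> edges M \<and> colour M {x, y} = c"

definition adj_flag :: "'f flag_graph \<Rightarrow> 'f \<Rightarrow> nat \<Rightarrow> 'f" where
  "adj_flag M x c = (THE y. adjacent M c x y)"

text \<open>\<open>word_flag M \<Phi> [c\<^sub>1, \<dots>, c\<^sub>m]\<close> applies \<open>c\<^sub>1\<close> first and \<open>c\<^sub>m\<close> last.\<close>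

definition word_flag :: "'f flag_graph \<Rightarrow> 'f \<Rightarrow> nat list \<Rightarrow> 'f" where
  "word_flag M x cs = foldl (adj_flag M) x cs"

text \<open>
  Elements of \<^term>\<open>Bij (flags M)\<close> are bijections of the flag set that are undefined
  outside it, so that equality of automorphisms is equality on flags.
\<close>

definition automorphisms :: "'f flag_graph \<Rightarrow> ('f \<Rightarrow> 'f) set" where
  "automorphisms M = {g \<in> Bij (flags M).
     (\<forall>x\<in>flags M. \<forall>y\<in>flags M. {g x, g y} \<in> edges M \<longleftrightarrow> {x, y} \<in> edges M) \<and>
     (\<forall>x\<in>flags M. \<forall>y\<in>flags M. {x, y} \<in> edges M \<longrightarrow> colour M {g x, g y} = colour M {x, y})}"

definition Aut :: "'f flag_graph \<Rightarrow> ('f \<Rightarrow> 'f) monoid" where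
  "Aut M = BijGroup (flags M) \<lparr>carrier := automorphisms M\<rparr>"

definition flag_orbit :: "'f flag_graph \<Rightarrow> 'f \<Rightarrow> 'f set" where
  "flag_orbit M x = (\<lambda>g. g x) ` carrier (Aut M)"

definition flag_orbits :: "'f flag_graph \<Rightarrow> 'f set set" where
  "flag_orbits M = flag_orbit M ` flags M"

definition k_orbit :: "'f flag_graph \<Rightarrow> nat \<Rightarrow> bool" where
  "k_orbit M k \<longleftrightarrow> finite (flag_orbits M) \<and> card (flag_orbits M) = k"

definition \<alpha> :: "'f flag_graph \<Rightarrow> 'f \<Rightarrow> nat list \<Rightarrow> 'f \<Rightarrow> 'f" where
  "\<alpha> M \<Phi> cs = (THE g. g \<in> carrier (Aut M) \<and> g \<Phi> = word_flag M \<Phi> cs)"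

text \<open>
  An edge of a coloured pregraph is the pair of its colour and its set of two ends, so
  parallel edges of different colours are different edges; a semi-edge is the pair of its
  colour and its unique end.
\<close>

record 'v pregraph =
  vertices :: "'v set"
  links :: "(nat \<times> 'v set) set"
  semi_edges :: "(nat \<times> 'v) set"

definition symmetry_type_graph :: "'f flag_graph \<Rightarrow> 'f set pregraph" where
  "symmetry_type_graph M =
    \<lparr>vertices = flag_orbits M,
     links = {(c, {B, C}) | c B C. B \<in> flag_orbits M \<and> C \<in> flag_orbits M \<and> B \<noteq> C \<and>
                (\<exists>x\<in>B. \<exists>y\<in>C. adjacent M c x y)},
     semi_edges = {(c, B) | c B. B \<in> flag_orbits M \<and> (\<exists>x\<in>B. \<exists>y\<in>B. adjacent M c x y)}\<rparr>"

text \<open>The path is \<open>v 1, e 1, v 2, \<dots>, e (k - 1), v k\<close>; other values of \<open>v\<close> and \<open>e\<close> are irrelevant.\<close>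

definition hamiltonian_path ::
    "'v pregraph \<Rightarrow> nat \<Rightarrow> (nat \<Rightarrow> 'v) \<Rightarrow> (nat \<Rightarrow> nat \<times> 'v set) \<Rightarrow> bool" where
  "hamiltonian_path T k v e \<longleftrightarrow>
     bij_betw v {1..k} (vertices T) \<and>
     (\<forall>m\<in>{1..<k}. e m \<in> links T \<and> snd (e m) = {v m, v (m + 1)})"

text \<open>The action on flags is free, so the description in the definition of \<open>\<alpha>\<close> is unique.\<close>

lemma (in maniplex) automorphisms_free:
  assumes g: "g \<in> carrier (Aut M)" and h: "h \<in> carrier (Aut M)"
    and x: "x \<in> flags M" and eq: "g x = h x"
  shows "g = h"
proof -
  have same: "y \<in> flags M \<and> g y = h y" if "(x, y) \<in> {(u, w). {u, w} \<in> edges M}\<^sup>*" for y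
    using that
  proof (induction rule: rtrancl_induct)
    case base
    then show ?case using x eq by simp
  next
    case (step y z)
    then have yz: "{y, z} \<in> edges M" "y \<in> flags M" "g y = h y" by auto
    then have zf: "z \<in> flags M" using simple[OF yz(1)] by (auto simp: doubleton_eq_iff)
    have "{g y, g z} \<in> edges M" "{h y, h z} \<in> edges M"
      "colour M {g y, g z} = colour M {h y, h z}"
      using g h yz zf by (auto simp: Aut_def automorphisms_def)
    then have "{g y, g z} = {h y, h z}"
      using proper[of "{g y, g z}" "{h y, h z}"] yz(3) by auto
    then show ?case using zf yz(3) by (auto simp: doubleton_eq_iff)
  qed
  show ?thesis
  proof (rule extensionalityI)
    show "g \<in> extensional (flags M)" "h \<in> extensional (flags M)"
      using g h by (auto simp: Aut_def automorphisms_def Bij_def)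
    show "g y = h y" if "y \<in> flags M" for y
      using same that connected[OF x] by (auto simp: component_def)
  qed
qed

lemma (in maniplex) \<alpha>_maps:
  assumes "\<Phi> \<in> flags M" and "word_flag M \<Phi> cs \<in> flag_orbit M \<Phi>"
  shows "\<alpha> M \<Phi> cs \<in> carrier (Aut M)" and "\<alpha> M \<Phi> cs \<Phi> = word_flag M \<Phi> cs"
proof -
  have "\<exists>!g. g \<in> carrier (Aut M) \<and> g \<Phi> = word_flag M \<Phi> cs"
    using assms automorphisms_free[OF _ _ assms(1)] by (auto simp: flag_orbit_def)
  from theI'[OF this] show "\<alpha> M \<Phi> cs \<in> carrier (Aut M)" "\<alpha> M \<Phi> cs \<Phi> = word_flag M \<Phi> cs"
    by (simp_all add: \<alpha>_def)
qed

end

(*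
  Let w_i be the flag reached from the base flag along the first i - 1 edges of the Hamiltonian
  path, so that w_i lies in v_i, and let H be the generated subgroup. The translates h(w_i) with
  h in H form a set of flags that is closed under adjacency: the c-neighbour of w_i is again some
  w_j if c is the colour of a path edge, and otherwise its image under one of the generators or an
  inverse is some w_j. By connectedness these are all the flags. An automorphism therefore sends
  the base flag to some h(w_i); comparing orbits gives i = 1, and the free action makes it equal
  to h.
*)

theory Submission
  imports Defs
begin

context maniplex
begin

section \<open>Adjacency and colour words in the flag graph\<close>

lemma adjacent_sym: "adjacent M c x y \<longleftrightarrow> adjacent M c y x"
  by (simp add: adjacent_def insert_commute)

lemma adjacentD:
  assumes "adjacent M c x y"
  shows "x \<in> flags M" "y \<in> flags M" "c < n"
  using assms simple[of "{x, y}"] colours[of "{x, y}"]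
  by (auto simp: adjacent_def doubleton_eq_iff)

lemma adjacent_unique:
  assumes "adjacent M c x y" "adjacent M c x z"
  shows "y = z"
  using assms proper[of "{x, y}" "{x, z}"] by (auto simp: adjacent_def doubleton_eq_iff)

lemma adj_flag_eq: "adjacent M c x y \<Longrightarrow> adj_flag M x c = y"
  unfolding adj_flag_def using adjacent_unique by blast

lemma adjacent_adj_flag:
  assumes "c < n" "x \<in> flags M"
  shows "adjacent M c x (adj_flag M x c)"
proof -
  obtain E where E: "E \<in> edges M" "colour M E = c" "x \<in> E"
    using perfect_matching[OF assms] by blast
  then obtain y where "E = {x, y}" using simple[OF E(1)] by auto
  then have "adjacent M c x y" using E by (simp add: adjacent_def)
  then show ?thesis using adj_flag_eq by simp
qed

lemma adj_flag_adj_flag: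
  assumes "c < n" "x \<in> flags M"
  shows "adj_flag M (adj_flag M x c) c = x"
  using adj_flag_eq adjacent_adj_flag[OF assms] adjacent_sym by blast

lemma word_flag_snoc: "word_flag M x (cs @ [c]) = adj_flag M (word_flag M x cs) c"
  by (simp add: word_flag_def)

lemma word_flag_closed:
  assumes "x \<in> flags M" "set cs \<subseteq> {..<n}"
  shows "word_flag M x cs \<in> flags M"
  using assms(2)
proof (induction cs rule: rev_induct)
  case Nil
  then show ?case using assms(1) by (simp add: word_flag_def)
next
  case (snoc c cs)
  then show ?case using adjacentD(2)[OF adjacent_adj_flag] by (simp add: word_flag_snoc)
qed

text \<open>Passing to the neighbour of a fixed colour below \<open>n\<close> is an involution, so
  the reversed word undoes the steps one at a time, the last one first.\<close>

lemma word_flag_rev: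
  assumes "x \<in> flags M" "set cs \<subseteq> {..<n}"
  shows "word_flag M (word_flag M x cs) (rev cs) = x"
  using assms(2)
proof (induction cs rule: rev_induct)
  case Nil
  then show ?case by (simp add: word_flag_def)
next
  case (snoc c cs)
  have "word_flag M (word_flag M x (cs @ [c])) (rev (cs @ [c])) =
      word_flag M (adj_flag M (adj_flag M (word_flag M x cs) c) c) (rev cs)"
    by (simp add: word_flag_def)
  also have "\<dots> = word_flag M (word_flag M x cs) (rev cs)"
    using snoc.prems adj_flag_adj_flag word_flag_closed[OF assms(1)] by simp
  finally show ?case using snoc by simp
qed

section \<open>The automorphism group and its action on flags\<close>

lemma subgroup_automorphisms: "subgroup (automorphisms M) (BijGroup (flags M))"
proof (rule group.subgroupI[OF group_BijGroup])
  show "automorphisms M \<subseteq> carrier (BijGroup (flags M))"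
    by (auto simp: automorphisms_def BijGroup_def)
  have "(\<lambda>x\<in>flags M. x) \<in> automorphisms M"
    by (auto simp: automorphisms_def id_Bij)
  then show "automorphisms M \<noteq> {}" by blast
next
  fix g assume g: "g \<in> automorphisms M"
  then have bij: "g \<in> Bij (flags M)" by (simp add: automorphisms_def)
  \<comment> \<open>The inverse is restricted to the flags, so that it is undefined elsewhere and is
    literally the inverse in \<open>BijGroup\<close>.\<close>
  let ?h = "\<lambda>x\<in>flags M. (inv_into (flags M) g) x"
  have h: "?h x \<in> flags M" "g (?h x) = x" if "x \<in> flags M" for x
    using that bij by (auto simp: Bij_def bij_betw_def inv_into_into f_inv_into_f)
  have edge: "{?h x, ?h y} \<in> edges M \<longleftrightarrow> {x, y} \<in> edges M"
    if "x \<in> flags M" "y \<in> flags M" for x y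
    using g h[OF that(1)] h[OF that(2)] unfolding automorphisms_def by fastforce
  have col: "colour M {?h x, ?h y} = colour M {x, y}"
    if "x \<in> flags M" "y \<in> flags M" "{x, y} \<in> edges M" for x y
  proof -
    \<comment> \<open>Automorphisms preserve colours only of pairs that are edges, so
      \<open>edge\<close> is applied first.\<close>
    have "colour M {g (?h x), g (?h y)} = colour M {?h x, ?h y}"
      using g h(1)[OF that(1)] h(1)[OF that(2)] edge[OF that(1,2)] that(3)
      unfolding automorphisms_def by blast
    then show ?thesis by (simp only: h(2)[OF that(1)] h(2)[OF that(2)])
  qed
  have "?h \<in> automorphisms M"
    unfolding automorphisms_def using edge col restrict_inv_into_Bij[OF bij] by blast
  then show "inv\<^bsub>BijGroup (flags M)\<^esub> g \<in> automorphisms M"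
    using inv_BijGroup[OF bij] by simp
next
  fix g h assume gh: "g \<in> automorphisms M" "h \<in> automorphisms M"
  then have bij: "g \<in> Bij (flags M)" "h \<in> Bij (flags M)" by (simp_all add: automorphisms_def)
  have "h x \<in> flags M" if "x \<in> flags M" for x
    using that bij(2) by (auto simp: Bij_def bij_betw_def)
  then have "compose (flags M) g h \<in> automorphisms M"
    using gh compose_Bij[OF bij] by (auto simp: automorphisms_def compose_def)
  then show "g \<otimes>\<^bsub>BijGroup (flags M)\<^esub> h \<in> automorphisms M"
    using bij by (simp add: BijGroup_def)
qed

text \<open>\<open>Aut M\<close> is the group of all bijections of the flags with a smaller carrier,
  so the subgroup property is exactly what makes it a group.\<close>

lemma group_Aut: "group (Aut M)"
  unfolding Aut_def
  by (rule subgroup.subgroup_is_group[OF subgroup_automorphisms group_BijGroup])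

lemma one_Aut_apply: "x \<in> flags M \<Longrightarrow> \<one>\<^bsub>Aut M\<^esub> x = x"
  by (simp add: Aut_def BijGroup_def)

lemma mult_Aut_apply:
  assumes "g \<in> carrier (Aut M)" "h \<in> carrier (Aut M)" "x \<in> flags M"
  shows "(g \<otimes>\<^bsub>Aut M\<^esub> h) x = g (h x)"
  using assms by (simp add: Aut_def BijGroup_def automorphisms_def compose_def)

lemma Aut_closed:
  assumes "g \<in> carrier (Aut M)" "x \<in> flags M"
  shows "g x \<in> flags M"
  using assms by (auto simp: Aut_def automorphisms_def Bij_def bij_betw_def)

lemma inv_Aut_apply:
  assumes "g \<in> carrier (Aut M)" "x \<in> flags M"
  shows "(inv\<^bsub>Aut M\<^esub> g) (g x) = x"
proof -
  interpret group "Aut M" by (rule group_Aut)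
  show ?thesis
    using mult_Aut_apply[of "inv\<^bsub>Aut M\<^esub> g" g x] assms one_Aut_apply by simp
qed

lemma Aut_adjacent:
  assumes "g \<in> carrier (Aut M)" "adjacent M c x y"
  shows "adjacent M c (g x) (g y)"
  using assms adjacentD[OF assms(2)] by (simp add: adjacent_def Aut_def automorphisms_def)

text \<open>The image of the \<open>c\<close>-edge at \<open>x\<close> is a \<open>c\<close>-edge at
  \<open>g x\<close>, and there is only one. This commutation of automorphisms with adjacency drives
  the whole argument.\<close>

lemma Aut_adj_flag:
  assumes "g \<in> carrier (Aut M)" "c < n" "x \<in> flags M"
  shows "g (adj_flag M x c) = adj_flag M (g x) c"
  using adj_flag_eq[OF Aut_adjacent[OF assms(1) adjacent_adj_flag[OF assms(2,3)]]] by simp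

lemma Aut_word_flag:
  assumes "g \<in> carrier (Aut M)" "set cs \<subseteq> {..<n}" "x \<in> flags M"
  shows "g (word_flag M x cs) = word_flag M (g x) cs"
  using assms(2)
proof (induction cs rule: rev_induct)
  case Nil
  then show ?case by (simp add: word_flag_def)
next
  case (snoc c cs)
  then show ?case
    using Aut_adj_flag[OF assms(1)] word_flag_closed[OF assms(3)] by (simp add: word_flag_snoc)
qed

section \<open>Flag orbits and the edges of the symmetry type graph\<close>

lemma flag_orbit_self: "x \<in> flags M \<Longrightarrow> x \<in> flag_orbit M x"
  using one_Aut_apply group.is_monoid[OF group_Aut] monoid.one_closed
  unfolding flag_orbit_def by (metis image_eqI)

lemma flag_orbits_flags: "\<lbrakk>Q \<in> flag_orbits M; x \<in> Q\<rbrakk> \<Longrightarrow> x \<in> flags M"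
  using Aut_closed by (auto simp: flag_orbits_def flag_orbit_def)

lemma flag_orbits_closed:
  assumes "Q \<in> flag_orbits M" "x \<in> Q" "g \<in> carrier (Aut M)"
  shows "g x \<in> Q"
proof -
  interpret group "Aut M" by (rule group_Aut)
  obtain z h where z: "z \<in> flags M" "Q = flag_orbit M z" "h \<in> carrier (Aut M)" "x = h z"
    using assms by (auto simp: flag_orbits_def flag_orbit_def)
  then have "g x = (g \<otimes>\<^bsub>Aut M\<^esub> h) z" using assms mult_Aut_apply by simp
  then show ?thesis using z assms(3) m_closed unfolding flag_orbit_def by blast
qed

lemma flag_orbits_transitive:
  assumes "Q \<in> flag_orbits M" "x \<in> Q" "y \<in> Q"
  obtains g where "g \<in> carrier (Aut M)" "g x = y"
proof -
  interpret group "Aut M" by (rule group_Aut)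
  obtain z h h' where z: "z \<in> flags M" "h \<in> carrier (Aut M)" "x = h z"
      "h' \<in> carrier (Aut M)" "y = h' z"
    using assms by (auto simp: flag_orbits_def flag_orbit_def)
  have "(h' \<otimes>\<^bsub>Aut M\<^esub> inv\<^bsub>Aut M\<^esub> h) x = y"
    using z mult_Aut_apply[of h' "inv\<^bsub>Aut M\<^esub> h" x] inv_Aut_apply Aut_closed by simp
  then show thesis using that z by blast
qed

text \<open>From a common flag, automorphisms reach every flag of either orbit without leaving the
  other, so each orbit contains the other.\<close>

lemma flag_orbits_disjoint:
  assumes "Q \<in> flag_orbits M" "Q' \<in> flag_orbits M" "x \<in> Q" "x \<in> Q'"
  shows "Q = Q'"
  using assms flag_orbits_closed flag_orbits_transitive
  by (metis subsetI subset_antisym)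

text \<open>A link supplies only one adjacent pair between \<open>C\<close> and \<open>D\<close>. An
  automorphism moving its end in \<open>C\<close> to \<open>x\<close> carries the other end to the
  neighbour of \<open>x\<close>, which therefore stays in \<open>D\<close>.\<close>

lemma adj_flag_in_orbit:
  assumes "(c, {C, D}) \<in> links (symmetry_type_graph M)" "x \<in> C"
  shows "adj_flag M x c \<in> D"
proof -
  obtain C' D' y' z' where "{C, D} = {C', D'}" "C' \<in> flag_orbits M" "D' \<in> flag_orbits M"
      "y' \<in> C'" "z' \<in> D'" "adjacent M c y' z'"
    using assms(1) by (auto simp: symmetry_type_graph_def)
  \<comment> \<open>The ends of a link are unordered, so the pair found may run from
    \<open>D\<close> to \<open>C\<close>; symmetry of adjacency turns it round.\<close>
  then have orb: "C \<in> flag_orbits M" "D \<in> flag_orbits M"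
    and "\<exists>y\<in>C. \<exists>z\<in>D. adjacent M c y z"
    using adjacent_sym[of c y' z'] by (auto simp: doubleton_eq_iff)
  then obtain y z where yz: "y \<in> C" "z \<in> D" "adjacent M c y z" by blast
  obtain g where g: "g \<in> carrier (Aut M)" "g y = x"
    using flag_orbits_transitive[OF orb(1) yz(1) assms(2)] .
  have "adj_flag M x c = g z" using adj_flag_eq[OF Aut_adjacent[OF g(1) yz(3)]] g(2) by simp
  then show ?thesis using flag_orbits_closed[OF orb(2) yz(2) g(1)] by simp
qed

lemma links_colour: "(c, E) \<in> links (symmetry_type_graph M) \<Longrightarrow> c < n"
  using adjacentD(3) by (auto simp: symmetry_type_graph_def)

section \<open>Recognising the automorphisms given by words, and connectedness\<close>

lemma \<alpha>_eq:
  assumes "x \<in> flags M" "g \<in> carrier (Aut M)" "g x = word_flag M x cs"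
  shows "\<alpha> M x cs = g"
  using assms automorphisms_free[OF _ _ assms(1)] unfolding \<alpha>_def by (intro the_equality) auto

text \<open>Walking back along \<open>ws\<close> from the flag at its end returns to
  \<open>x\<close>, and \<open>g\<close> commutes with this walk. With \<open>us\<close> and
  \<open>ws\<close> initial segments of the path colours, both families of generators have this
  form; \<open>us = ws\<close> gives the semi-edge case.\<close>

lemma \<alpha>_conjugate_eq:
  assumes "x \<in> flags M" "c < n" "set us \<subseteq> {..<n}" "set ws \<subseteq> {..<n}"
    and g: "g \<in> carrier (Aut M)" "g (word_flag M x ws) = adj_flag M (word_flag M x us) c"
  shows "\<alpha> M x (us @ [c] @ rev ws) = g"
proof (rule \<alpha>_eq[OF assms(1) g(1)])
  have "g x = g (word_flag M (word_flag M x ws) (rev ws))"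
    using word_flag_rev assms by simp
  also have "\<dots> = word_flag M (adj_flag M (word_flag M x us) c) (rev ws)"
    using Aut_word_flag[OF g(1)] g(2) word_flag_closed assms by simp
  also have "\<dots> = word_flag M x (us @ [c] @ rev ws)" by (simp add: word_flag_def)
  finally show "g x = word_flag M x (us @ [c] @ rev ws)" .
qed

text \<open>By connectedness every flag is reached from \<open>x\<close> along edges, and each edge
  is a step to the neighbour of its colour.\<close>

lemma adj_flag_closed_eq_flags:
  assumes "x \<in> X" "x \<in> flags M"
    and closed: "\<And>y c. \<lbrakk>y \<in> X; y \<in> flags M; c < n\<rbrakk> \<Longrightarrow> adj_flag M y c \<in> X"
  shows "flags M \<subseteq> X"
proof
  fix z assume "z \<in> flags M"
  then have "(x, z) \<in> {(u, w). {u, w} \<in> edges M}\<^sup>*"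
    using connected[OF assms(2)] by (auto simp: component_def)
  then show "z \<in> X"
  proof (induction rule: rtrancl_induct)
    case base
    then show ?case using assms(1) .
  next
    case (step y z)
    then have adj: "adjacent M (colour M {y, z}) y z" by (simp add: adjacent_def)
    show ?case
      using closed[OF step.IH adjacentD(1,3)[OF adj]] adj_flag_eq[OF adj] by simp
  qed
qed

end

section \<open>Generation of the automorphism group along the Hamiltonian path\<close>

theorem theorem5p2:
  fixes M :: "'f flag_graph" and n k :: nat
    and v :: "nat \<Rightarrow> 'f set" and e :: "nat \<Rightarrow> nat \<times> 'f set set"
    and a :: "nat \<Rightarrow> nat" and S :: "nat \<Rightarrow> nat set" and B :: "nat \<Rightarrow> nat \<Rightarrow> nat set"
    and \<Phi> :: 'f
  assumes "maniplex M n" and "k_orbit M k"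
    and "hamiltonian_path (symmetry_type_graph M) k v e"
    and "\<And>m. m \<in> {1..<k} \<Longrightarrow> a m = fst (e m)"
    and "\<And>i. i \<in> {1..k} \<Longrightarrow> S i = {s \<in> {0..<n}. (s, v i) \<in> semi_edges (symmetry_type_graph M)}"
    and "\<And>i j. \<lbrakk>1 \<le> i; i < j; j \<le> k\<rbrakk> \<Longrightarrow>
           B i j = {b. (b, {v i, v j}) \<in> links (symmetry_type_graph M) - e ` {1..<k}}"
    and "\<Phi> \<in> v 1"
  shows "carrier (Aut M) = generate (Aut M)
    ({\<alpha> M \<Phi> (map a [1..<i] @ [s] @ rev (map a [1..<i])) | i s. 1 \<le> i \<and> i \<le> k \<and> s \<in> S i} \<union>
     {\<alpha> M \<Phi> (map a [1..<i] @ [b] @ rev (map a [1..<j])) | i j b. 1 \<le> i \<and> i < j \<and> j \<le> k \<and> b \<in> B i j})"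
proof -
  interpret maniplex M n by fact
  interpret group "Aut M" by (rule group_Aut)
  let ?T = "symmetry_type_graph M"
  define w where "w i = word_flag M \<Phi> (map a [1..<i])" for i
  define Gen where "Gen = {\<alpha> M \<Phi> (map a [1..<i] @ [s] @ rev (map a [1..<i])) | i s.
        1 \<le> i \<and> i \<le> k \<and> s \<in> S i} \<union>
     {\<alpha> M \<Phi> (map a [1..<i] @ [b] @ rev (map a [1..<j])) | i j b.
        1 \<le> i \<and> i < j \<and> j \<le> k \<and> b \<in> B i j}"
  let ?H = "generate (Aut M) Gen"
  have Gen_semi: "\<alpha> M \<Phi> (map a [1..<i] @ [s] @ rev (map a [1..<i])) \<in> Gen"
    if "1 \<le> i" "i \<le> k" "s \<in> S i" for i s
    using that unfolding Gen_def by blast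
  have Gen_link: "\<alpha> M \<Phi> (map a [1..<i] @ [b] @ rev (map a [1..<j])) \<in> Gen"
    if "1 \<le> i" "i < j" "j \<le> k" "b \<in> B i j" for i j b
    using that unfolding Gen_def by blast
  have v: "bij_betw v {1..k} (flag_orbits M)"
    using assms(3) by (simp add: hamiltonian_path_def symmetry_type_graph_def)
  have e: "e m \<in> links ?T" "snd (e m) = {v m, v (m + 1)}" if "m \<in> {1..<k}" for m
    using assms(3) that by (auto simp: hamiltonian_path_def)
  have orb: "v i \<in> flag_orbits M" if "i \<in> {1..k}" for i
    using v that by (auto simp: bij_betw_def)
  have v_eq: "i = j" if "i \<in> {1..k}" "j \<in> {1..k}" "x \<in> v i" "x \<in> v j" for i j x
    using flag_orbits_disjoint[OF orb orb] v that unfolding bij_betw_def inj_on_def by metis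
  have v_ex: "\<exists>i\<in>{1..k}. x \<in> v i" if "x \<in> flags M" for x
  proof -
    have "flag_orbit M x \<in> v ` {1..k}"
      using v that by (simp add: bij_betw_def flag_orbits_def)
    then show ?thesis using flag_orbit_self[OF that] by force
  qed
  \<comment> \<open>Some flag exists and its orbit has an index in \<open>{1..k}\<close>; hence
    \<open>v 1\<close> really is an orbit.\<close>
  have "k \<ge> 1" using nonempty v_ex by fastforce
  then have one: "1 \<in> {1..k}" by simp
  have \<Phi>: "\<Phi> \<in> flags M" using flag_orbits_flags[OF orb[OF one] assms(7)] .
  have path: "e m = (a m, {v m, v (m + 1)})" if "m \<in> {1..<k}" for m
    using e(2)[OF that] assms(4)[OF that] by (metis prod.collapse)
  have link: "(a m, {v m, v (m + 1)}) \<in> links ?T" if "m \<in> {1..<k}" for m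
    using e(1)[OF that] path[OF that] by simp
  \<comment> \<open>The list \<open>[1..<i]\<close> stops before \<open>i\<close>, so for
    \<open>i \<le> k\<close> only colours of actual path edges occur.\<close>
  have a: "set (map a [1..<i]) \<subseteq> {..<n}" if "i \<in> {1..k}" for i
    using links_colour[OF link] that by auto
  have w_Suc: "w (Suc i) = adj_flag M (w i) (a i)" if "i \<ge> 1" for i
    using that by (simp add: w_def word_flag_snoc)
  have w1: "w 1 = \<Phi>" by (simp add: w_def word_flag_def)
  have w: "w i \<in> v i" if "i \<in> {1..k}" for i
  proof -
    have "1 \<le> i" "i \<le> k" using that by auto
    then show ?thesis
    proof (induction i rule: dec_induct)
      case base
      then show ?case using w1 assms(7) by simp
    next
      case (step i)
      then show ?case using adj_flag_in_orbit[OF link] w_Suc[of i] by simp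
    qed
  qed
  have wf: "w i \<in> flags M" if "i \<in> {1..k}" for i
    using flag_orbits_flags[OF orb w] that by blast
  \<comment> \<open>The generators thus become automorphisms that send \<open>w j\<close> to the
    \<open>c\<close>-neighbour of \<open>w i\<close>; the rest of the proof uses them only in this
    form.\<close>
  have \<alpha>: "\<alpha> M \<Phi> (map a [1..<i] @ [c] @ rev (map a [1..<j])) = g"
    if "i \<in> {1..k}" "j \<in> {1..k}" "c < n" "g \<in> carrier (Aut M)" "g (w j) = adj_flag M (w i) c"
    for i j c g
    using \<alpha>_conjugate_eq[OF \<Phi> that(3) a[OF that(1)] a[OF that(2)] that(4)] that(5)
    by (simp add: w_def)
  have transport: "\<exists>g\<in>carrier (Aut M). g (w j) = adj_flag M (w i) c"
    if "j \<in> {1..k}" "adj_flag M (w i) c \<in> v j" for i j c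
    using flag_orbits_transitive[OF orb[OF that(1)] w[OF that(1)] that(2)] by metis

  \<comment> \<open>As \<open>\<alpha>\<close> is a definite description, each word needs a witness:
    the neighbour of \<open>w i\<close> lies in the orbit of \<open>w j\<close>, so some
    automorphism connects the two.\<close>
  have Gen: "Gen \<subseteq> carrier (Aut M)"
  proof -
    have "\<alpha> M \<Phi> (map a [1..<i] @ [s] @ rev (map a [1..<i])) \<in> carrier (Aut M)"
      if "1 \<le> i" "i \<le> k" "s \<in> S i" for i s
    proof -
      have i: "i \<in> {1..k}" using that by simp
      then have s: "s < n" "(s, v i) \<in> semi_edges ?T" using that(3) assms(5)[OF i] by auto
      then obtain x y where xy: "x \<in> v i" "y \<in> v i" "adjacent M s x y"
        by (auto simp: symmetry_type_graph_def)
      \<comment> \<open>The semi-edge concerns some pair \<open>x\<close>, \<open>y\<close> of the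
        orbit; \<open>g\<close> moves that pair so that it starts at \<open>w i\<close>.\<close>
      obtain g where g: "g \<in> carrier (Aut M)" "g x = w i"
        using flag_orbits_transitive[OF orb[OF i] xy(1) w[OF i]] .
      have "adj_flag M (w i) s = g y"
        using adj_flag_eq[OF Aut_adjacent[OF g(1) xy(3)]] g(2) by simp
      then have "adj_flag M (w i) s \<in> v i" using flag_orbits_closed[OF orb[OF i] xy(2) g(1)] by simp
      then show ?thesis using transport[OF i] \<alpha>[OF i i s(1)] by blast
    qed
    moreover have "\<alpha> M \<Phi> (map a [1..<i] @ [b] @ rev (map a [1..<j])) \<in> carrier (Aut M)"
      if "1 \<le> i" "i < j" "j \<le> k" "b \<in> B i j" for i j b
    proof -
      have ij: "i \<in> {1..k}" "j \<in> {1..k}" using that by auto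
      have l: "(b, {v i, v j}) \<in> links ?T" using assms(6)[OF that(1-3)] that(4) by auto
      show ?thesis
        using transport[OF ij(2) adj_flag_in_orbit[OF l w[OF ij(1)]]] \<alpha>[OF ij links_colour[OF l]]
        by blast
    qed
    ultimately show ?thesis unfolding Gen_def by blast
  qed
  interpret H: subgroup ?H "Aut M" using generate_is_subgroup[OF Gen] .

  \<comment> \<open>Generators exist only for \<open>i \<le> j\<close>, so this direction comes
    first. The edge is a semi-edge, a path edge or one of the remaining links.\<close>
  have upward: "\<exists>g\<in>?H. g (w j) = adj_flag M (w i) c"
    if ij: "i \<in> {1..k}" "j \<in> {1..k}" "i \<le> j" and c: "c < n" "adj_flag M (w i) c \<in> v j" for i j c
  proof -
    have adj: "adjacent M c (w i) (adj_flag M (w i) c)" using adjacent_adj_flag[OF c(1) wf[OF ij(1)]] .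
    obtain g where g: "g \<in> carrier (Aut M)" "g (w j) = adj_flag M (w i) c"
      using transport[OF ij(2) c(2)] by blast
    have \<alpha>g: "\<alpha> M \<Phi> (map a [1..<i] @ [c] @ rev (map a [1..<j])) = g"
      using \<alpha>[OF ij(1,2) c(1) g] .
    show ?thesis
    proof (cases "i = j")
      case True
      then have "(c, v i) \<in> semi_edges ?T"
        using orb[OF ij(1)] w[OF ij(1)] c(2) adj by (auto simp: symmetry_type_graph_def)
      then have "c \<in> S i" using c(1) assms(5)[OF ij(1)] by simp
      then have "g \<in> Gen" using Gen_semi[of i c] \<alpha>g True ij(1) by simp
      then show ?thesis using g(2) generate.incl[of g Gen] by blast
    next
      case False
      then have less: "1 \<le> i" "i < j" "j \<le> k" using ij by auto
      have "v i \<noteq> v j" using False v_eq[OF ij(1,2) w[OF ij(1)]] w[OF ij(1)] by auto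
      then have l: "(c, {v i, v j}) \<in> links ?T"
        using orb[OF ij(1)] orb[OF ij(2)] w[OF ij(1)] c(2) adj
        by (auto simp: symmetry_type_graph_def)
      show ?thesis
      proof (cases "(c, {v i, v j}) \<in> e ` {1..<k}")
        case True
        then obtain m where m: "m \<in> {1..<k}" "c = a m" "{v i, v j} = {v m, v (m + 1)}"
          using path by auto
        \<comment> \<open>As \<open>v\<close> is injective, equal sets of ends have equal indices;
          \<open>i < j\<close> then excludes the reversed reading.\<close>
        have "{i, j} = {m, m + 1}"
        proof (rule inj_on_image_eq_iff[THEN iffD1])
          show "inj_on v {1..k}" using v by (simp add: bij_betw_def)
        qed (use ij m in auto)
        then have "m = i" "j = Suc i" using less by (auto simp: doubleton_eq_iff)
        then have "w j = adj_flag M (w i) c" using w_Suc less m by simp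
        \<comment> \<open>A path edge leads from \<open>w i\<close> to \<open>w j\<close> itself, so
          the identity suffices.\<close>
        then show ?thesis using H.one_closed one_Aut_apply[OF wf[OF ij(2)]] by metis
      next
        case False
        then have "c \<in> B i j" using l assms(6)[OF less] by simp
        then have "g \<in> Gen" using Gen_link[OF less, of c] \<alpha>g by simp
        then show ?thesis using g(2) generate.incl[of g Gen] by blast
      qed
    qed
  qed
  have neighbour: "\<exists>g\<in>?H. \<exists>j\<in>{1..k}. g (w j) = adj_flag M (w i) c"
    if i: "i \<in> {1..k}" and c: "c < n" for i c
  proof -
    let ?x = "adj_flag M (w i) c"
    have x: "?x \<in> flags M" using adjacentD(2)[OF adjacent_adj_flag[OF c wf[OF i]]] .
    obtain j where j: "j \<in> {1..k}" "?x \<in> v j" using v_ex[OF x] by blast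
    show ?thesis
    proof (cases "i \<le> j")
      case True
      then show ?thesis using upward[OF i j(1) True c j(2)] j(1) by blast
    next
      \<comment> \<open>For \<open>j < i\<close> the edge is read from its other end: the
        \<open>c\<close>-neighbour of \<open>w j\<close> lies in \<open>v i\<close>, so
        \<open>upward\<close> gives \<open>h\<close> with \<open>h (w i)\<close> equal to it.
        Applying adjacency once more, \<open>h\<close> maps \<open>?x\<close> to \<open>w j\<close>,
        and the inverse of \<open>h\<close> is the element sought.\<close>
      case False
      obtain g where g: "g \<in> carrier (Aut M)" "g (w j) = ?x" using transport[OF j] by blast
      let ?y = "adj_flag M (w j) c"
      have "g ?y = w i" using Aut_adj_flag[OF g(1) c wf[OF j(1)]] adj_flag_adj_flag[OF c wf[OF i]] g(2)
        by simp
      then have "?y = (inv\<^bsub>Aut M\<^esub> g) (w i)"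
        using inv_Aut_apply[OF g(1) adjacentD(2)[OF adjacent_adj_flag[OF c wf[OF j(1)]]]] by simp
      then have "?y \<in> v i" using flag_orbits_closed[OF orb[OF i] w[OF i]] g(1) by simp
      then obtain h where h: "h \<in> ?H" "h (w i) = ?y" using upward[OF j(1) i _ c] False by auto
      then have hA: "h \<in> carrier (Aut M)" using H.mem_carrier by blast
      have "h ?x = w j"
        using Aut_adj_flag[OF hA c wf[OF i]] adj_flag_adj_flag[OF c wf[OF j(1)]] h(2) by simp
      then have "(inv\<^bsub>Aut M\<^esub> h) (w j) = ?x" using inv_Aut_apply[OF hA x] by simp
      then show ?thesis using H.m_inv_closed[OF h(1)] j(1) by blast
    qed
  qed

  \<comment> \<open>The translates of the path flags exhaust all flags\<close>
  let ?X = "{h (w i) | h i. h \<in> ?H \<and> i \<in> {1..k}}"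
  have "flags M \<subseteq> ?X"
  proof (rule adj_flag_closed_eq_flags[OF _ \<Phi>])
    have "\<Phi> = \<one>\<^bsub>Aut M\<^esub> (w 1)" using w1 one_Aut_apply[OF \<Phi>] by simp
    then show "\<Phi> \<in> ?X" using one H.one_closed by blast
  next
    fix y c assume "y \<in> ?X" and c: "c < n"
    then obtain h i where h: "h \<in> ?H" "i \<in> {1..k}" "y = h (w i)" by blast
    obtain g j where g: "g \<in> ?H" "j \<in> {1..k}" "g (w j) = adj_flag M (w i) c"
      using neighbour[OF h(2) c] by blast
    have A: "h \<in> carrier (Aut M)" "g \<in> carrier (Aut M)" using h(1) g(1) H.mem_carrier by auto
    \<comment> \<open>The neighbour of \<open>h (w i)\<close> is the image under \<open>h\<close> of
      the neighbour of \<open>w i\<close>, which is \<open>g (w j)\<close>.\<close>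
    have "adj_flag M y c = (h \<otimes>\<^bsub>Aut M\<^esub> g) (w j)"
      using Aut_adj_flag[OF A(1) c wf[OF h(2)]] mult_Aut_apply[OF A wf[OF g(2)]] g(3) h(3) by simp
    then show "adj_flag M y c \<in> ?X" using H.m_closed[OF h(1) g(1)] g(2) by blast
  qed
  have "carrier (Aut M) \<subseteq> ?H"
  proof
    fix g assume g: "g \<in> carrier (Aut M)"
    then obtain h i where h: "h \<in> ?H" "i \<in> {1..k}" "g \<Phi> = h (w i)"
      using \<open>flags M \<subseteq> ?X\<close> Aut_closed[OF g \<Phi>] by blast
    have hA: "h \<in> carrier (Aut M)" using h(1) H.mem_carrier by blast
    \<comment> \<open>The flag \<open>g \<Phi>\<close> lies in \<open>v 1\<close>, whereas
      \<open>h (w i)\<close> lies in \<open>v i\<close>.\<close>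
    have "i = 1"
      using v_eq[OF h(2) one flag_orbits_closed[OF orb[OF h(2)] w[OF h(2)] hA]]
        flag_orbits_closed[OF orb[OF one] assms(7) g] h(3) by simp
    then have "g = h" using automorphisms_free[OF g hA \<Phi>] h(3) w1 by simp
    then show "g \<in> ?H" using h(1) by simp
  qed
  then show ?thesis using H.subset unfolding Gen_def by blast
qed

end
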